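(* Let $F^z$ be the problem of minimizing $\sum_{j\in P}\omega_j\theta_j$ over the set $\Omega^z$ of all $(x,z,\theta)$ with $x\in Q$, $z\in\{0,1\}^{p\times p}$, $\theta\in\mathbb{R}^p$ satisfying (b) $\sum_{i\in P}z_{ij}=1$ for all $j\in P$; (c) $\sum_{j\in P}z_{ij}=1$ for all $i\in P$; (d) $C^i x\le \theta_j+M\bigl(1-\sum_{k\ge j}z_{ik}\bigr)$ for all $i,j\in P$; (e) $\theta_j\ge\theta_{j+1}$ for all $j\in P$, $j<p$. Let $F^z_{R1}$ be the problem of minimizing the same objective over the set $\Omega^z_{R1}$ of all $(x,z,\theta)$ with $x\in Q$, $z\in\{0,1\}^{p\times p}$, $\theta\in\mathbb{R}^p$ satisfying (b), (c), (d). Then every optimal solution to $F^z_{R1}$ is also optimal to $F^z$.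
   Context: $P=\{1,\dots,p\}$. $Q\subseteq\mathbb{R}^n$ is the feasible set of a combinatorial optimization problem (a combinatorial object representable by a system of linear inequalities). $C\in\mathbb{R}^{p\times n}$ is a matrix whose rows $C^i$, $i\in P$, are the cost vectors of $p$ objective (cost) functions $x\mapsto C^i x$. $\omega=(\omega_j)_{j\in P}$ is a vector of non-negative weights. $M$ is a non-negative upper bound on the value of all the cost functions, i.e. $M\ge 0$ and $C^i x\le M$ for all $x\in Q$, $i\in P$.
   Formalization: The claim fails if some weight is zero (p=2, ω=(1,0), C=0, M=0, θ=(0,1)); it is proved literally when all ω_j>0, and for ω≥0 as: (x,z,θ') is optimal to F^z for some θ' equal to θ wherever ω_j>0. *)

theory Defs
  imports "Jordan_Normal_Form.Matrix"
begin

text \<open>Indices are 0-based, as in the matrix library: the set \<open>P = {1, ..., p}\<close> becomes \<open>{..<p}\<close>.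
  The row of the cost matrix belonging to objective \<open>i\<close> is \<open>row C i\<close>.\<close>

definition assignment_matrix :: "nat \<Rightarrow> real mat \<Rightarrow> bool" where
  "assignment_matrix p z \<longleftrightarrow>
     z \<in> carrier_mat p p \<and>
     (\<forall>i<p. \<forall>j<p. z $$ (i, j) \<in> {0, 1}) \<and>
     (\<forall>j<p. (\<Sum>i<p. z $$ (i, j)) = 1) \<and>
     (\<forall>i<p. (\<Sum>j<p. z $$ (i, j)) = 1)"

definition Omega_R1 ::
    "nat \<Rightarrow> real vec set \<Rightarrow> real mat \<Rightarrow> real \<Rightarrow> (real vec \<times> real mat \<times> real vec) set" where
  "Omega_R1 p Q C M =
     {(x, z, \<theta>). x \<in> Q \<and> assignment_matrix p z \<and> \<theta> \<in> carrier_vec p \<and>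
        (\<forall>i<p. \<forall>j<p. row C i \<bullet> x \<le> \<theta> $ j + M * (1 - (\<Sum>k\<in>{j..<p}. z $$ (i, k))))}"

definition Omega ::
    "nat \<Rightarrow> real vec set \<Rightarrow> real mat \<Rightarrow> real \<Rightarrow> (real vec \<times> real mat \<times> real vec) set" where
  "Omega p Q C M =
     {(x, z, \<theta>). x \<in> Q \<and> assignment_matrix p z \<and> \<theta> \<in> carrier_vec p \<and>
        (\<forall>i<p. \<forall>j<p. row C i \<bullet> x \<le> \<theta> $ j + M * (1 - (\<Sum>k\<in>{j..<p}. z $$ (i, k)))) \<and>
        (\<forall>j. j + 1 < p \<longrightarrow> \<theta> $ j \<ge> \<theta> $ (j + 1))}"

definition objective :: "nat \<Rightarrow> real vec \<Rightarrow> real vec \<times> real mat \<times> real vec \<Rightarrow> real" where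
  "objective p \<omega> = (\<lambda>(x, z, \<theta>). \<Sum>j<p. \<omega> $ j * \<theta> $ j)"

definition optimal_Fz ::
    "nat \<Rightarrow> real vec set \<Rightarrow> real mat \<Rightarrow> real \<Rightarrow> real vec \<Rightarrow> real vec \<times> real mat \<times> real vec \<Rightarrow> bool" where
  "optimal_Fz p Q C M \<omega> = is_arg_min (objective p \<omega>) (\<lambda>s. s \<in> Omega p Q C M)"

definition optimal_Fz_R1 ::
    "nat \<Rightarrow> real vec set \<Rightarrow> real mat \<Rightarrow> real \<Rightarrow> real vec \<Rightarrow> real vec \<times> real mat \<times> real vec \<Rightarrow> bool" where
  "optimal_Fz_R1 p Q C M \<omega> = is_arg_min (objective p \<omega>) (\<lambda>s. s \<in> Omega_R1 p Q C M)"

text \<open>A variable \<open>\<theta>\<^sub>j\<close> of weight zero does not occur in the objective, so an optimal solution of the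
  relaxation may take it arbitrarily large and violate the ordering constraint of \<open>Omega\<close>. Hence,
  for weights that are merely non-negative, an optimal triple of the relaxation need not be feasible
  for the full formulation: \<open>p = 2\<close>, \<open>\<omega> = (1, 0)\<close>, \<open>C = 0\<close>, \<open>M = 0\<close>, \<open>\<theta> = (0, 1)\<close>.\<close>

lemma zero_weight_counterexample:
  fixes Q C M \<omega> \<theta>
  defines "Q \<equiv> {0\<^sub>v 1}" and "C \<equiv> 0\<^sub>m 2 1" and "M \<equiv> 0"
    and "\<omega> \<equiv> vec 2 (\<lambda>j. if j = 0 then 1 else 0)"
    and "\<theta> \<equiv> vec 2 (\<lambda>j. if j = 0 then 0 else 1)"
  shows "optimal_Fz_R1 2 Q C M \<omega> (0\<^sub>v 1, 1\<^sub>m 2, \<theta>)"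
    and "\<not> optimal_Fz 2 Q C M \<omega> (0\<^sub>v 1, 1\<^sub>m 2, \<theta>)"
proof -
  have cost: "row C i \<bullet> 0\<^sub>v 1 = 0" if "i < 2" for i
    using that unfolding C_def by (simp add: scalar_prod_def)
  have lt2: "(\<forall>i<2. R i) \<longleftrightarrow> R 0 \<and> R 1" for R :: "nat \<Rightarrow> bool"
    by (auto simp: less_2_cases_iff)
  have sum2: "(\<Sum>i<2. f i) = f 0 + f 1" for f :: "nat \<Rightarrow> real"
    by (simp add: numeral_2_eq_2)
  have asg: "assignment_matrix 2 (1\<^sub>m 2)"
    unfolding assignment_matrix_def lt2 sum2 by simp
  have feas: "(0\<^sub>v 1, 1\<^sub>m 2, \<theta>) \<in> Omega_R1 2 Q C M"
    using asg cost unfolding Omega_R1_def Q_def M_def \<theta>_def by auto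
  have obj: "objective 2 \<omega> (x, z, t) = t $ 0" for x z t
    unfolding objective_def \<omega>_def by (simp add: sum2)
  have low: "t $ 0 \<ge> 0" if "(x, z, t) \<in> Omega_R1 2 Q C M" for x z t
    using that cost[of 0] unfolding Omega_R1_def Q_def M_def by force
  show "optimal_Fz_R1 2 Q C M \<omega> (0\<^sub>v 1, 1\<^sub>m 2, \<theta>)"
    unfolding optimal_Fz_R1_def is_arg_min_def using feas low
    by (auto simp: obj \<theta>_def not_less)
  show "\<not> optimal_Fz 2 Q C M \<omega> (0\<^sub>v 1, 1\<^sub>m 2, \<theta>)"
    unfolding optimal_Fz_def is_arg_min_def Omega_def \<theta>_def by auto
qed

end

(* For fixed x and z, constraint (d) reads theta_j >= bound_ij for all i, so its least solution is
   theta_j = max_i bound_ij. Since z >= 0 and M >= 0, every bound_ij is non-increasing in j, hence so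
   is this least solution: it satisfies (e) automatically. An optimal theta of the relaxation agrees
   with it in every coordinate of positive weight. *)
theory Submission
  imports Defs
begin

definition theta_bound :: "nat \<Rightarrow> real mat \<Rightarrow> real \<Rightarrow> real vec \<Rightarrow> real mat \<Rightarrow> nat \<Rightarrow> nat \<Rightarrow> real" where
  "theta_bound p C M x z i j = row C i \<bullet> x - M * (1 - (\<Sum>k\<in>{j..<p}. z $$ (i, k)))"

text \<open>For \<open>p = 0\<close> the vector has no entries, so the \<open>Max\<close> of the
  empty set is never read.\<close>

definition least_theta :: "nat \<Rightarrow> real mat \<Rightarrow> real \<Rightarrow> real vec \<Rightarrow> real mat \<Rightarrow> real vec" where
  "least_theta p C M x z = vec p (\<lambda>j. Max ((\<lambda>i. theta_bound p C M x z i j) ` {..<p}))"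

lemma Omega_R1_iff:
  "(x, z, \<theta>) \<in> Omega_R1 p Q C M \<longleftrightarrow>
     x \<in> Q \<and> assignment_matrix p z \<and> \<theta> \<in> carrier_vec p \<and>
     (\<forall>i<p. \<forall>j<p. theta_bound p C M x z i j \<le> \<theta> $ j)"
  unfolding Omega_R1_def theta_bound_def by (auto simp: algebra_simps)

lemma Omega_iff:
  "(x, z, \<theta>) \<in> Omega p Q C M \<longleftrightarrow>
     (x, z, \<theta>) \<in> Omega_R1 p Q C M \<and> (\<forall>j. j + 1 < p \<longrightarrow> \<theta> $ (j + 1) \<le> \<theta> $ j)"
  unfolding Omega_def Omega_R1_def by auto

text \<open>Passing from \<open>j\<close> to \<open>Suc j\<close> drops the single term
  \<open>z $$ (i, j)\<close>, which is 0 or 1, from the tail sum, and multiplying by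
  \<open>M \<ge> 0\<close> keeps the direction. For \<open>Suc j = p\<close> the remaining sum is
  empty.\<close>

lemma theta_bound_Suc_le:
  assumes z: "assignment_matrix p z" and "M \<ge> 0" and "i < p" and "j < p"
  shows "theta_bound p C M x z i (Suc j) \<le> theta_bound p C M x z i j"
proof -
  have "z $$ (i, j) \<in> {0, 1}"
    using z \<open>i < p\<close> \<open>j < p\<close> unfolding assignment_matrix_def by blast
  then have "z $$ (i, j) \<ge> 0"
    by auto
  then have "(\<Sum>k\<in>{Suc j..<p}. z $$ (i, k)) \<le> (\<Sum>k\<in>{j..<p}. z $$ (i, k))"
    using \<open>j < p\<close> by (simp add: sum.atLeast_Suc_lessThan)
  then show ?thesis
    using \<open>M \<ge> 0\<close> unfolding theta_bound_def by (simp add: mult_left_mono)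
qed

lemma least_theta_in_carrier [simp]: "least_theta p C M x z \<in> carrier_vec p"
  unfolding least_theta_def by simp

lemma least_theta_upper:
  assumes "i < p" and "j < p"
  shows "theta_bound p C M x z i j \<le> least_theta p C M x z $ j"
  using assms unfolding least_theta_def by simp

lemma least_theta_least:
  assumes "j < p" and "\<And>i. i < p \<Longrightarrow> theta_bound p C M x z i j \<le> t"
  shows "least_theta p C M x z $ j \<le> t"
proof -
  have "{..<p} \<noteq> {}"
    using \<open>j < p\<close> by auto
  then show ?thesis
    using assms unfolding least_theta_def by simp
qed

text \<open>A maximum of finitely many non-increasing sequences is non-increasing, which gives the
  ordering constraint. Any feasible \<open>\<theta>\<close> serves, optimal or not, since only its
  \<open>x\<close> and \<open>z\<close> are kept.\<close>

lemma least_theta_feasible: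
  assumes "(x, z, \<theta>) \<in> Omega_R1 p Q C M" and "M \<ge> 0"
  shows "(x, z, least_theta p C M x z) \<in> Omega p Q C M"
proof -
  have z: "assignment_matrix p z"
    using assms(1) by (simp add: Omega_R1_iff)
  have "least_theta p C M x z $ Suc j \<le> least_theta p C M x z $ j" if "Suc j < p" for j
  proof (rule least_theta_least[OF that])
    fix i assume "i < p"
    then have "theta_bound p C M x z i (Suc j) \<le> theta_bound p C M x z i j"
      using theta_bound_Suc_le[OF z \<open>M \<ge> 0\<close>] that by simp
    also have "\<dots> \<le> least_theta p C M x z $ j"
      using least_theta_upper \<open>i < p\<close> that by simp
    finally show "theta_bound p C M x z i (Suc j) \<le> least_theta p C M x z $ j" .
  qed
  then show ?thesis
    using assms(1) by (simp add: Omega_iff Omega_R1_iff least_theta_upper)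
qed

text \<open>An exchange argument: replacing \<open>\<theta>\<close> by the least solution for the
  same \<open>x\<close> and \<open>z\<close> keeps feasibility and lowers no coordinate's cost below
  what optimality permits, so the two objective values coincide.\<close>

lemma optimal_Fz_R1_least_theta:
  assumes opt: "optimal_Fz_R1 p Q C M \<omega> (x, z, \<theta>)"
    and nonneg: "\<forall>j<p. \<omega> $ j \<ge> 0" and M: "M \<ge> 0"
  shows "\<forall>j<p. \<omega> $ j > 0 \<longrightarrow> least_theta p C M x z $ j = \<theta> $ j"
    and "optimal_Fz p Q C M \<omega> (x, z, least_theta p C M x z)"
proof -
  let ?t = "least_theta p C M x z"
  have feas: "(x, z, \<theta>) \<in> Omega_R1 p Q C M"
    and min: "\<And>s. s \<in> Omega_R1 p Q C M \<Longrightarrow> objective p \<omega> (x, z, \<theta>) \<le> objective p \<omega> s"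
    using opt unfolding optimal_Fz_R1_def is_arg_min_def by (auto simp: not_less)
  have t_feas: "(x, z, ?t) \<in> Omega p Q C M"
    using least_theta_feasible[OF feas M] .
  have sub: "s \<in> Omega_R1 p Q C M" if "s \<in> Omega p Q C M" for s
    using that by (cases s) (simp add: Omega_iff)
  have t_le: "?t $ j \<le> \<theta> $ j" if "j < p" for j
    using feas that by (intro least_theta_least) (auto simp: Omega_R1_iff)
  have term_le: "\<omega> $ j * ?t $ j \<le> \<omega> $ j * \<theta> $ j" if "j < p" for j
    using t_le nonneg that by (simp add: mult_left_mono)
  have "(\<Sum>j<p. \<omega> $ j * ?t $ j) \<le> (\<Sum>j<p. \<omega> $ j * \<theta> $ j)"
    using term_le by (intro sum_mono) simp
  \<comment> \<open>Optimality of \<open>\<theta>\<close> is tested against the least solution,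
    itself a point of the relaxation.\<close>
  moreover have "(\<Sum>j<p. \<omega> $ j * \<theta> $ j) \<le> (\<Sum>j<p. \<omega> $ j * ?t $ j)"
    using min[OF sub[OF t_feas]] by (simp add: objective_def)
  ultimately have eq: "(\<Sum>j<p. \<omega> $ j * ?t $ j) = (\<Sum>j<p. \<omega> $ j * \<theta> $ j)"
    by simp
  show "\<forall>j<p. \<omega> $ j > 0 \<longrightarrow> ?t $ j = \<theta> $ j"
  proof (intro allI impI)
    fix j assume "j < p" "\<omega> $ j > 0"
    \<comment> \<open>Equal sums of termwise ordered summands agree term by term; the positive
      weight then cancels.\<close>
    have "\<omega> $ j * ?t $ j = \<omega> $ j * \<theta> $ j"
      using sum_mono_inv[OF eq, of j] term_le \<open>j < p\<close> by simp
    then show "?t $ j = \<theta> $ j"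
      using \<open>\<omega> $ j > 0\<close> by simp
  qed
  have "objective p \<omega> (x, z, ?t) = objective p \<omega> (x, z, \<theta>)"
    using eq by (simp add: objective_def)
  \<comment> \<open>A point of the smaller set \<open>Omega\<close> that attains the minimum over
    \<open>Omega_R1\<close> is also minimal over \<open>Omega\<close>.\<close>
  then show "optimal_Fz p Q C M \<omega> (x, z, ?t)"
    using t_feas min sub unfolding optimal_Fz_def is_arg_min_def by (simp add: not_less)
qed

text \<open>The first conjunct is the claim for positive weights. By
  \<open>zero_weight_counterexample\<close> it can fail when a weight vanishes; the second conjunct
  then keeps \<open>x\<close> and \<open>z\<close> and changes \<open>\<theta>\<close> only in
  coordinates of weight zero.\<close>

theorem mainTheorem2:
  fixes n p :: nat and Q :: "real vec set" and C :: "real mat" and M :: real and \<omega> :: "real vec"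
  assumes "Q \<subseteq> carrier_vec n"
    and "C \<in> carrier_mat p n"
    and "\<omega> \<in> carrier_vec p"
    and "\<forall>j<p. \<omega> $ j \<ge> 0"
    and "M \<ge> 0"
    and "\<forall>x\<in>Q. \<forall>i<p. row C i \<bullet> x \<le> M"
  shows "((\<forall>j<p. \<omega> $ j > 0) \<longrightarrow>
            (\<forall>x z \<theta>. optimal_Fz_R1 p Q C M \<omega> (x, z, \<theta>) \<longrightarrow> optimal_Fz p Q C M \<omega> (x, z, \<theta>))) \<and>
         (\<forall>x z \<theta>. optimal_Fz_R1 p Q C M \<omega> (x, z, \<theta>) \<longrightarrow>
            (\<exists>\<theta>'. (\<forall>j<p. \<omega> $ j > 0 \<longrightarrow> \<theta>' $ j = \<theta> $ j) \<and> optimal_Fz p Q C M \<omega> (x, z, \<theta>')))"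
proof (intro conjI impI allI)
  fix x z \<theta>
  assume pos: "\<forall>j<p. \<omega> $ j > 0" and opt: "optimal_Fz_R1 p Q C M \<omega> (x, z, \<theta>)"
  have "\<theta> \<in> carrier_vec p"
    using opt unfolding optimal_Fz_R1_def is_arg_min_def by (simp add: Omega_R1_iff)
  then have "least_theta p C M x z = \<theta>"
    using optimal_Fz_R1_least_theta(1)[OF opt assms(4,5)] pos
    by (intro eq_vecI) (auto simp: least_theta_def)
  then show "optimal_Fz p Q C M \<omega> (x, z, \<theta>)"
    using optimal_Fz_R1_least_theta(2)[OF opt assms(4,5)] by simp
next
  fix x z \<theta>
  assume "optimal_Fz_R1 p Q C M \<omega> (x, z, \<theta>)"
  \<comment> \<open>The witness is \<open>least_theta p C M x z\<close>.\<close>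
  then show "\<exists>\<theta>'. (\<forall>j<p. \<omega> $ j > 0 \<longrightarrow> \<theta>' $ j = \<theta> $ j) \<and> optimal_Fz p Q C M \<omega> (x, z, \<theta>')"
    using optimal_Fz_R1_least_theta assms(4,5) by blast
qed

end
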